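(* The lumped bilinear form is coercive on $\Sigma_{k,k',h}$: $(\mathcal{A}\tau,\tau)_h\gtrsim\|\tau\|_0^2$ for all $\tau\in\Sigma_{k,k',h}$, with a constant independent of $h$.
   Context: $\mathbb{S}$ real symmetric $2\times2$ matrices; $\mathcal{A}\sigma=\frac{1}{2\mu}\big(\sigma-\frac{\lambda}{2\mu+2\lambda}\mathrm{tr}(\sigma)I\big)$, $\lambda,\mu>0$; $A:B=\sum_{ij}a_{ij}b_{ij}$. $\{\mathcal{T}_h\}$ conforming shape-regular triangulations of polygonal $\Omega\subset\mathbb{R}^2$. For integers $k'>k\ge3$: $b_K=\lambda_1\lambda_2\lambda_3$, $P_i^{hom}(K;X)$ homogeneous polynomials of degree $i$, $P_{k,k'}(K;X)=P_k(K;X)+b_KP_{k'-3}(K;X)$; $\Sigma_{k,h}=\{\tau\in H^1(\Omega;\mathbb{S}):\tau|_K\in P_k(K;\mathbb{S})\}+\{\tau\in H(\mathrm{div},\Omega;\mathbb{S}):\tau|_K\in P_k(K;\mathbb{S}),\ \tau\nu|_{\partial K}=0\ \forall K\}$, $\Lambda_{k,k'}=\{\tau\in H(\mathrm{div},\Omega;\mathbb{S}):\tau|_K\in\sum_{i=k-2}^{k'-3}b_KP_i^{hom}(K;\mathbb{S})\ \forall K\}$, $\Sigma_{k,k',h}=\Sigma_{k,h}\oplus\Lambda_{k,k'}$. Quadrature: on each $K$, nodes $\chi_1,\dots,\chi_r\in K$ (images under the affine map $F_K$ of fixed reference nodes) form a unisolvent Lagrange node set for $P_{k,k'}(K;\mathbb{R})$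 (vertices included, and the nodes on each edge are unisolvent for polynomials of degree $k$ on that edge), and $I_{k,k',K}(g)=\sum_{i=1}^r w_ig(\chi_i)$ with (B1) all weights $w_i>0$ and (B2) $I_{k,k',K}(g)=\int_Kg\,dx$ for all $g\in P_{k+k'-2}(K)$. The lumped form is $(\mathcal{A}\sigma,\tau)_h=\sum_{K\in\mathcal{T}_h}I_{k,k',K}(\mathcal{A}\sigma:\tau)$. *)

theory Defs
  imports "HOL-Analysis.Analysis" "HOL-Computational_Algebra.Polynomial"
begin

type_synonym pt = "real^2"
type_synonym mat2 = "real^2^2"

section \<open>Matrices\<close>

definition frob :: "mat2 \<Rightarrow> mat2 \<Rightarrow> real" where
  "frob A B = (\<Sum>i\<in>UNIV. \<Sum>j\<in>UNIV. A$i$j * B$i$j)"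

definition tr2 :: "mat2 \<Rightarrow> real" where
  "tr2 A = A$1$1 + A$2$2"

text \<open>Compliance tensor: A sigma = 1/(2 mu) (sigma - lambda/(2mu+2lambda) tr(sigma) I).\<close>
definition Acomp :: "real \<Rightarrow> real \<Rightarrow> mat2 \<Rightarrow> mat2" where
  "Acomp lam mu A = (1 / (2 * mu)) *\<^sub>R (A - (lam / (2 * mu + 2 * lam) * tr2 A) *\<^sub>R mat 1)"

section \<open>Triangles and triangulations\<close>

definition triangle :: "pt set \<Rightarrow> bool" where
  "triangle K \<longleftrightarrow> (\<exists>a b c. \<not> collinear {a, b, c} \<and> K = convex hull {a, b, c})"

definition verts :: "pt set \<Rightarrow> pt set" where
  "verts K = {v. v extreme_point_of K}"

definition ref_tri :: "pt set" where
  "ref_tri = convex hull {0, axis 1 1, axis 2 1}"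

text \<open>Barycentric coordinate of x w.r.t. vertex v of the triangle K.\<close>
definition bary :: "pt set \<Rightarrow> pt \<Rightarrow> pt \<Rightarrow> real" where
  "bary K v x = (THE l. (\<forall>w. w \<notin> verts K \<longrightarrow> l w = 0) \<and>
                        (\<Sum>w\<in>verts K. l w) = 1 \<and>
                        (\<Sum>w\<in>verts K. l w *\<^sub>R w) = x) v"

text \<open>Element bubble b_K = lambda_1 lambda_2 lambda_3.\<close>
definition bubble :: "pt set \<Rightarrow> pt \<Rightarrow> real" where
  "bubble K x = (\<Prod>v\<in>verts K. bary K v x)"

definition conforming_triangulation :: "pt set \<Rightarrow> pt set set \<Rightarrow> bool" where
  "conforming_triangulation \<Omega> T \<longleftrightarrow>
     finite T \<and> T \<noteq> {} \<and> (\<forall>K\<in>T. triangle K) \<and> \<Union>T = closure \<Omega> \<and>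
     (\<forall>K\<in>T. \<forall>K'\<in>T. K \<noteq> K' \<longrightarrow>
        K \<inter> K' = {} \<or>
        (\<exists>v. v \<in> verts K \<inter> verts K' \<and> K \<inter> K' = {v}) \<or>
        (\<exists>a b. a \<noteq> b \<and> a \<in> verts K \<inter> verts K' \<and> b \<in> verts K \<inter> verts K' \<and>
               K \<inter> K' = closed_segment a b))"

definition polygonal_domain :: "pt set \<Rightarrow> bool" where
  "polygonal_domain \<Omega> \<longleftrightarrow> open \<Omega> \<and> connected \<Omega> \<and> bounded \<Omega> \<and> \<Omega> \<noteq> {} \<and>
     interior (closure \<Omega>) = \<Omega> \<and>
     (\<exists>T. finite T \<and> (\<forall>K\<in>T. triangle K) \<and> \<Union>T = closure \<Omega>)"

definition inradius :: "pt set \<Rightarrow> real" where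
  "inradius K = Sup {r. \<exists>x. ball x r \<subseteq> K}"

text \<open>Shape regularity of a family of triangulations: diam K / rho_K uniformly bounded.\<close>
definition shape_regular :: "pt set set set \<Rightarrow> bool" where
  "shape_regular F \<longleftrightarrow> (\<exists>s. \<forall>T\<in>F. \<forall>K\<in>T. diameter K \<le> s * inradius K)"

section \<open>Polynomials in two variables\<close>

definition poly2 :: "nat \<Rightarrow> (pt \<Rightarrow> real) set" where
  "poly2 n = {f. \<exists>c. \<forall>x. f x = (\<Sum>i\<le>n. \<Sum>j\<le>n - i. c i j * x$1 ^ i * x$2 ^ j)}"

text \<open>Sum of the spaces of homogeneous polynomials of degrees a, ..., b.\<close>
definition homsum2 :: "nat \<Rightarrow> nat \<Rightarrow> (pt \<Rightarrow> real) set" where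
  "homsum2 a b = {f. \<exists>c. \<forall>x. f x = (\<Sum>i\<in>{a..b}. \<Sum>j\<le>i. c i j * x$1 ^ j * x$2 ^ (i - j))}"

text \<open>Symmetric-matrix-valued functions with all entries in V.\<close>
definition symmat_in :: "(pt \<Rightarrow> real) set \<Rightarrow> (pt \<Rightarrow> mat2) \<Rightarrow> bool" where
  "symmat_in V p \<longleftrightarrow> (\<forall>i j. (\<lambda>x. p x $ i $ j) \<in> V) \<and> (\<forall>x. transpose (p x) = p x)"

text \<open>P_{k,k'}(K) = P_k(K) + b_K P_{k'-3}(K).\<close>
definition Pkk :: "nat \<Rightarrow> nat \<Rightarrow> pt set \<Rightarrow> (pt \<Rightarrow> real) set" where
  "Pkk k k' K = {(\<lambda>x. p x + bubble K x * q x) | p q. p \<in> poly2 k \<and> q \<in> poly2 (k' - 3)}"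

text \<open>tau restricted to K (a.e., i.e. on the interior) lies in P_n(K;S).\<close>
definition restr_poly :: "nat \<Rightarrow> pt set \<Rightarrow> (pt \<Rightarrow> mat2) \<Rightarrow> bool" where
  "restr_poly n K \<tau> \<longleftrightarrow> (\<exists>p. symmat_in (poly2 n) p \<and> (\<forall>x\<in>interior K. \<tau> x = p x))"

text \<open>tau restricted to K lies in sum_{i=k-2}^{k'-3} b_K P_i^hom(K;S).\<close>
definition restr_bubble :: "nat \<Rightarrow> nat \<Rightarrow> pt set \<Rightarrow> (pt \<Rightarrow> mat2) \<Rightarrow> bool" where
  "restr_bubble k k' K \<tau> \<longleftrightarrow>
     (\<exists>q. symmat_in (homsum2 (k - 2) (k' - 3)) q \<and> (\<forall>x\<in>interior K. \<tau> x = bubble K x *\<^sub>R q x))"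

text \<open>Value of tau|_K (continuous extension from the interior of K) at x.\<close>
definition elem_val :: "pt set \<Rightarrow> (pt \<Rightarrow> mat2) \<Rightarrow> pt \<Rightarrow> mat2" where
  "elem_val K \<tau> x = Lim (at x within interior K) \<tau>"

definition edge_normal :: "pt \<Rightarrow> pt \<Rightarrow> pt" where
  "edge_normal a b = vector [- ((b - a) $ 2), (b - a) $ 1]"

text \<open>tau nu = 0 on the boundary of K (for the element-wise polynomial).\<close>
definition zero_normal_trace :: "pt set \<Rightarrow> (pt \<Rightarrow> mat2) \<Rightarrow> bool" where
  "zero_normal_trace K \<tau> \<longleftrightarrow> (\<forall>a\<in>verts K. \<forall>b\<in>verts K. a \<noteq> b \<longrightarrow>
      (\<forall>x\<in>closed_segment a b. elem_val K \<tau> x *v edge_normal a b = 0))"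

section \<open>Sobolev-type spaces\<close>

definition partial :: "2 \<Rightarrow> (pt \<Rightarrow> real) \<Rightarrow> pt \<Rightarrow> real" where
  "partial l f x = frechet_derivative f (at x) (axis l 1)"

fun Ck :: "nat \<Rightarrow> (pt \<Rightarrow> real) \<Rightarrow> bool" where
  "Ck 0 f = continuous_on UNIV f"
| "Ck (Suc n) f = ((\<forall>x. f differentiable (at x)) \<and> (\<forall>l. Ck n (partial l f)))"

definition test_fun :: "pt set \<Rightarrow> (pt \<Rightarrow> real) \<Rightarrow> bool" where
  "test_fun \<Omega> \<phi> \<longleftrightarrow> (\<forall>n. Ck n \<phi>) \<and> compact (closure {x. \<phi> x \<noteq> 0}) \<and>
                      closure {x. \<phi> x \<noteq> 0} \<subseteq> \<Omega>"

definition L2 :: "pt set \<Rightarrow> (pt \<Rightarrow> real) \<Rightarrow> bool" where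
  "L2 \<Omega> f \<longleftrightarrow> f \<in> borel_measurable (lebesgue_on \<Omega>) \<and> integrable (lebesgue_on \<Omega>) (\<lambda>x. (f x)\<^sup>2)"

definition L2S :: "pt set \<Rightarrow> (pt \<Rightarrow> mat2) \<Rightarrow> bool" where
  "L2S \<Omega> \<tau> \<longleftrightarrow> (\<forall>x\<in>\<Omega>. transpose (\<tau> x) = \<tau> x) \<and> (\<forall>i j. L2 \<Omega> (\<lambda>x. \<tau> x $ i $ j))"

definition H1S :: "pt set \<Rightarrow> (pt \<Rightarrow> mat2) \<Rightarrow> bool" where
  "H1S \<Omega> \<tau> \<longleftrightarrow> L2S \<Omega> \<tau> \<and>
     (\<forall>i j l. \<exists>g. L2 \<Omega> g \<and> (\<forall>\<phi>. test_fun \<Omega> \<phi> \<longrightarrow>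
        integral\<^sup>L (lebesgue_on \<Omega>) (\<lambda>x. \<tau> x $ i $ j * partial l \<phi> x) =
        - integral\<^sup>L (lebesgue_on \<Omega>) (\<lambda>x. g x * \<phi> x)))"

definition HdivS :: "pt set \<Rightarrow> (pt \<Rightarrow> mat2) \<Rightarrow> bool" where
  "HdivS \<Omega> \<tau> \<longleftrightarrow> L2S \<Omega> \<tau> \<and>
     (\<forall>i. \<exists>g. L2 \<Omega> g \<and> (\<forall>\<phi>. test_fun \<Omega> \<phi> \<longrightarrow>
        integral\<^sup>L (lebesgue_on \<Omega>) (\<lambda>x. \<Sum>j\<in>UNIV. \<tau> x $ i $ j * partial j \<phi> x) =
        - integral\<^sup>L (lebesgue_on \<Omega>) (\<lambda>x. g x * \<phi> x)))"

definition L2sq :: "pt set \<Rightarrow> (pt \<Rightarrow> mat2) \<Rightarrow> real" where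
  "L2sq \<Omega> \<tau> = integral\<^sup>L (lebesgue_on \<Omega>) (\<lambda>x. frob (\<tau> x) (\<tau> x))"

section \<open>Finite element spaces\<close>

definition Sigma_kh :: "nat \<Rightarrow> pt set \<Rightarrow> pt set set \<Rightarrow> (pt \<Rightarrow> mat2) set" where
  "Sigma_kh k \<Omega> T =
     {(\<lambda>x. \<sigma>1 x + \<sigma>2 x) | \<sigma>1 \<sigma>2.
        (H1S \<Omega> \<sigma>1 \<and> (\<forall>K\<in>T. restr_poly k K \<sigma>1)) \<and>
        (HdivS \<Omega> \<sigma>2 \<and> (\<forall>K\<in>T. restr_poly k K \<sigma>2 \<and> zero_normal_trace K \<sigma>2))}"

definition Lambda_kk :: "nat \<Rightarrow> nat \<Rightarrow> pt set \<Rightarrow> pt set set \<Rightarrow> (pt \<Rightarrow> mat2) set" where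
  "Lambda_kk k k' \<Omega> T = {\<tau>. HdivS \<Omega> \<tau> \<and> (\<forall>K\<in>T. restr_bubble k k' K \<tau>)}"

definition Sigma_kkh :: "nat \<Rightarrow> nat \<Rightarrow> pt set \<Rightarrow> pt set set \<Rightarrow> (pt \<Rightarrow> mat2) set" where
  "Sigma_kkh k k' \<Omega> T =
     {(\<lambda>x. \<sigma> x + \<tau> x) | \<sigma> \<tau>. \<sigma> \<in> Sigma_kh k \<Omega> T \<and> \<tau> \<in> Lambda_kk k k' \<Omega> T}"

section \<open>Quadrature\<close>

definition unisolvent :: "(pt \<Rightarrow> real) set \<Rightarrow> (nat \<Rightarrow> pt) \<Rightarrow> nat \<Rightarrow> bool" where
  "unisolvent V nd r \<longleftrightarrow> (\<forall>c. \<exists>!p. p \<in> V \<and> (\<forall>i<r. p (nd i) = c i))"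

definition edge_param :: "pt \<Rightarrow> pt \<Rightarrow> pt \<Rightarrow> real" where
  "edge_param a b x = ((x - a) \<bullet> (b - a)) / ((b - a) \<bullet> (b - a))"

text \<open>The nodes lying on the edge [a,b] are unisolvent for polynomials of degree k on that edge.\<close>
definition edge_unisolvent :: "nat \<Rightarrow> pt \<Rightarrow> pt \<Rightarrow> (nat \<Rightarrow> pt) \<Rightarrow> nat \<Rightarrow> bool" where
  "edge_unisolvent k a b nd r \<longleftrightarrow>
     (\<forall>c. \<exists>!p :: real poly. degree p \<le> k \<and>
        (\<forall>i<r. nd i \<in> closed_segment a b \<longrightarrow> poly p (edge_param a b (nd i)) = c i))"

text \<open>Lumped form (A sigma, tau)_h = sum_K sum_i w_i (A sigma|_K(chi_i)) : tau|_K(chi_i).\<close>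
definition lumped :: "real \<Rightarrow> real \<Rightarrow> nat \<Rightarrow> (pt set \<Rightarrow> nat \<Rightarrow> real) \<Rightarrow>
                      (pt set \<Rightarrow> nat \<Rightarrow> pt) \<Rightarrow> pt set set \<Rightarrow> (pt \<Rightarrow> mat2) \<Rightarrow> (pt \<Rightarrow> mat2) \<Rightarrow> real" where
  "lumped lam mu r w nd T \<sigma> \<tau> =
     (\<Sum>K\<in>T. \<Sum>i<r. w K i * frob (Acomp lam mu (elem_val K \<sigma> (nd K i))) (elem_val K \<tau> (nd K i)))"

end

theory Submission
  imports Defs
begin

text \<open>
  On every triangle K the field \<open>\<tau>\<close> is a symmetric matrix of functions from
  \<open>P\<^sub>k\<^sub>,\<^sub>k\<^sub>'(K)\<close>, and this space is the affine pullback of one fixed space on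
  the reference triangle. Unisolvence of the nodes gives a reference Lagrange basis
  \<open>\<phi>\<^sub>j\<close>; since \<open>k' \<le> k + k' - 2\<close>, exactness of the rule applied to the pushed
  forward \<open>\<phi>\<^sub>j\<close> yields \<open>w\<^sub>j = |det B\<^sub>K| \<integral> \<phi>\<^sub>j\<close>. Hence on every element the
  weights are one common set of positive reference masses scaled by the Jacobian, and
  expanding \<open>p = \<Sum> p(\<chi>\<^sub>j) \<phi>\<^sub>j\<close> with Cauchy-Schwarz bounds \<open>\<integral>\<^sub>K p\<^sup>2\<close> by a
  reference constant times \<open>\<Sum> w\<^sub>j p(\<chi>\<^sub>j)\<^sup>2\<close>. Pointwise coercivity of the compliance
  tensor, \<open>\<A>X : X \<ge> |X|\<^sup>2 / (2(\<mu> + \<lambda>))\<close>, and summation over the elements finish the proof.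
\<close>

section \<open>Bivariate polynomials\<close>

lemma poly2I:
  "(\<And>x. f x = (\<Sum>i\<le>n. \<Sum>j\<le>n - i. c i j * x$1 ^ i * x$2 ^ j)) \<Longrightarrow> f \<in> poly2 n"
  unfolding poly2_def by blast

lemma poly2_zero: "(\<lambda>x. 0) \<in> poly2 n"
  by (rule poly2I[where c = "\<lambda>i j. 0"]) simp

lemma poly2_add:
  assumes "f \<in> poly2 n" "g \<in> poly2 n"
  shows "(\<lambda>x. f x + g x) \<in> poly2 n"
proof -
  obtain c d where
    "\<And>x. f x = (\<Sum>i\<le>n. \<Sum>j\<le>n - i. c i j * x$1 ^ i * x$2 ^ j)"
    "\<And>x. g x = (\<Sum>i\<le>n. \<Sum>j\<le>n - i. d i j * x$1 ^ i * x$2 ^ j)"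
    using assms unfolding poly2_def by blast
  then show ?thesis
    by (intro poly2I[where c = "\<lambda>i j. c i j + d i j"]) (simp add: distrib_right sum.distrib)
qed

lemma poly2_scale:
  assumes "f \<in> poly2 n"
  shows "(\<lambda>x. a * f x) \<in> poly2 n"
proof -
  obtain c where "\<And>x. f x = (\<Sum>i\<le>n. \<Sum>j\<le>n - i. c i j * x$1 ^ i * x$2 ^ j)"
    using assms unfolding poly2_def by blast
  then show ?thesis
    by (intro poly2I[where c = "\<lambda>i j. a * c i j"]) (simp add: sum_distrib_left mult.assoc)
qed

lemma poly2_sum:
  "finite A \<Longrightarrow> (\<And>a. a \<in> A \<Longrightarrow> f a \<in> poly2 n) \<Longrightarrow> (\<lambda>x. \<Sum>a\<in>A. f a x) \<in> poly2 n"
  by (induction A rule: finite_induct) (auto intro: poly2_zero poly2_add)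

lemma poly2_monomial:
  assumes "a + b \<le> n"
  shows "(\<lambda>x. x$1 ^ a * x$2 ^ b) \<in> poly2 n"
proof -
  define c where "c i j = (if i = a \<and> j = b then 1 else (0::real))" for i j
  have "(\<Sum>j\<le>n - i. c i j * x$1 ^ i * x$2 ^ j) = (if i = a then x$1 ^ a * x$2 ^ b else 0)"
    for i and x :: pt
    using assms by (cases "i = a") (simp_all add: c_def if_distrib[of "\<lambda>t. t * _"] cong: if_cong)
  then show ?thesis
    using assms by (intro poly2I[where c = c]) simp
qed

lemma poly2_const: "(\<lambda>x. a) \<in> poly2 n"
  using poly2_scale[OF poly2_monomial[of 0 0 n], of a] by simp

lemma poly2_mono:
  assumes "f \<in> poly2 n" "n \<le> m"
  shows "f \<in> poly2 m"
proof -
  obtain c where f: "\<And>x. f x = (\<Sum>i\<le>n. \<Sum>j\<le>n - i. c i j * x$1 ^ i * x$2 ^ j)"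
    using assms(1) unfolding poly2_def by blast
  have "(\<lambda>x. \<Sum>i\<le>n. \<Sum>j\<le>n - i. c i j * (x$1 ^ i * x$2 ^ j)) \<in> poly2 m"
    using assms(2) by (intro poly2_sum finite_atMost poly2_scale poly2_monomial) auto
  then show ?thesis by (simp add: f[abs_def] mult.assoc)
qed

lemma poly2_mult:
  assumes "f \<in> poly2 n" "g \<in> poly2 m"
  shows "(\<lambda>x. f x * g x) \<in> poly2 (n + m)"
proof -
  obtain c d where
    f: "\<And>x. f x = (\<Sum>i\<le>n. \<Sum>j\<le>n - i. c i j * x$1 ^ i * x$2 ^ j)" and
    g: "\<And>x. g x = (\<Sum>k\<le>m. \<Sum>l\<le>m - k. d k l * x$1 ^ k * x$2 ^ l)"
    using assms unfolding poly2_def by blast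
  have "f x * g x = (\<Sum>i\<le>n. \<Sum>j\<le>n - i. \<Sum>k\<le>m. \<Sum>l\<le>m - k.
           (c i j * d k l) * (x$1 ^ (i + k) * x$2 ^ (j + l)))" for x
    unfolding f g sum_distrib_right unfolding sum_distrib_left by (simp add: power_add mult_ac)
  moreover have "(\<lambda>x. \<Sum>i\<le>n. \<Sum>j\<le>n - i. \<Sum>k\<le>m. \<Sum>l\<le>m - k.
           (c i j * d k l) * (x$1 ^ (i + k) * x$2 ^ (j + l))) \<in> poly2 (n + m)"
    by (intro poly2_sum finite_atMost poly2_scale poly2_monomial) auto
  ultimately show ?thesis by simp
qed

lemma poly2_power: "f \<in> poly2 1 \<Longrightarrow> (\<lambda>x. f x ^ m) \<in> poly2 m"
  by (induction m) (use poly2_const poly2_mult in fastforce)+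

lemma poly2_affine_comp:
  fixes B :: "real^2^2"
  assumes "f \<in> poly2 n"
  shows "(\<lambda>x. f (B *v x + c)) \<in> poly2 n"
proof -
  obtain a where f: "\<And>y. f y = (\<Sum>i\<le>n. \<Sum>j\<le>n - i. a i j * y$1 ^ i * y$2 ^ j)"
    using assms unfolding poly2_def by blast
  have coord: "(\<lambda>x. (B *v x + c) $ l) \<in> poly2 1" for l
  proof -
    have "(B *v x + c) $ l = B$l$1 * (x$1 ^ 1 * x$2 ^ 0) + B$l$2 * (x$1 ^ 0 * x$2 ^ 1) + c$l" for x :: pt
      by (simp add: matrix_vector_mult_def sum_2)
    moreover have "(\<lambda>x::pt. B$l$1 * (x$1 ^ 1 * x$2 ^ 0) + B$l$2 * (x$1 ^ 0 * x$2 ^ 1) + c$l) \<in> poly2 1"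
      by (intro poly2_add poly2_scale poly2_monomial poly2_const) auto
    ultimately show ?thesis by simp
  qed
  have "(\<lambda>x. \<Sum>i\<le>n. \<Sum>j\<le>n - i. a i j * ((B *v x + c)$1 ^ i * (B *v x + c)$2 ^ j)) \<in> poly2 n"
  proof (intro poly2_sum finite_atMost poly2_scale)
    fix i j assume "i \<in> {..n}" "j \<in> {..n - i}"
    then have "i + j \<le> n" by auto
    then show "(\<lambda>x. (B *v x + c)$1 ^ i * (B *v x + c)$2 ^ j) \<in> poly2 n"
      by (rule poly2_mono[OF poly2_mult[OF poly2_power[OF coord] poly2_power[OF coord]]])
  qed
  then show ?thesis by (simp add: f mult.assoc)
qed

lemma poly2_continuous:
  assumes "f \<in> poly2 n"
  shows "continuous_on UNIV f"
proof -
  obtain c where "f = (\<lambda>x. \<Sum>i\<le>n. \<Sum>j\<le>n - i. c i j * x$1 ^ i * x$2 ^ j)"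
    using assms unfolding poly2_def by blast
  then show ?thesis by (simp only:) (intro continuous_intros)
qed

lemma homsum2_subset_poly2: "homsum2 a b \<subseteq> poly2 b"
proof
  fix f assume "f \<in> homsum2 a b"
  then obtain c where f: "\<And>x. f x = (\<Sum>i\<in>{a..b}. \<Sum>j\<le>i. c i j * x$1 ^ j * x$2 ^ (i - j))"
    unfolding homsum2_def by blast
  have "(\<lambda>x. \<Sum>i\<in>{a..b}. \<Sum>j\<le>i. c i j * (x$1 ^ j * x$2 ^ (i - j))) \<in> poly2 b"
    by (intro poly2_sum finite_atLeastAtMost finite_atMost poly2_scale poly2_monomial) auto
  then show "f \<in> poly2 b" by (simp add: f[abs_def] mult.assoc)
qed

section \<open>Affine images of the reference triangle\<close>

abbreviation e1 :: pt where "e1 \<equiv> axis 1 1"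
abbreviation e2 :: pt where "e2 \<equiv> axis 2 1"

definition affine_element :: "real^2^2 \<Rightarrow> pt \<Rightarrow> pt set \<Rightarrow> bool" where
  "affine_element B c K \<longleftrightarrow> invertible B \<and> K = (\<lambda>y. B *v y + c) ` ref_tri"

definition ref_coords :: "real^2^2 \<Rightarrow> pt \<Rightarrow> pt \<Rightarrow> pt" where
  "ref_coords B c x = matrix_inv B *v (x - c)"

lemma invertible_matrix_inv:
  fixes B :: "real^2^2"
  assumes "invertible B"
  shows "B ** matrix_inv B = mat 1" "matrix_inv B ** B = mat 1"
  using someI_ex[OF assms[unfolded invertible_def]] unfolding matrix_inv_def by auto

lemma ref_coords_affine: "invertible B \<Longrightarrow> ref_coords B c (B *v y + c) = y"
  by (simp add: ref_coords_def matrix_vector_mul_assoc invertible_matrix_inv)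

lemma affine_ref_coords: "invertible B \<Longrightarrow> B *v ref_coords B c x + c = x"
  by (simp add: ref_coords_def matrix_vector_mul_assoc invertible_matrix_inv)

lemma invertible_matrix_vector_eq_0:
  fixes B :: "real^2^2"
  shows "invertible B \<Longrightarrow> B *v v = 0 \<Longrightarrow> v = 0"
  using ref_coords_affine[of B 0 v] by (simp add: ref_coords_def)

lemma affine_image_ref_vertices:
  fixes B :: "real^2^2" and c :: pt
  assumes "invertible B"
  shows "\<not> affine_dependent {c, B *v e1 + c, B *v e2 + c}"
    and "c \<noteq> B *v e1 + c" "c \<noteq> B *v e2 + c" "B *v e1 + c \<noteq> B *v e2 + c"
proof -
  have e: "u *\<^sub>R e1 + v *\<^sub>R e2 = 0 \<longleftrightarrow> u = 0 \<and> v = 0" for u v :: real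
    by (auto simp: vec_eq_iff forall_2 axis_def)
  have B0: "B *v (u *\<^sub>R e1 + v *\<^sub>R e2) = 0 \<Longrightarrow> u = 0 \<and> v = 0" for u v
    using invertible_matrix_vector_eq_0[OF assms] e by blast
  show dist: "c \<noteq> B *v e1 + c" "c \<noteq> B *v e2 + c" "B *v e1 + c \<noteq> B *v e2 + c"
    using B0[of 1 0] B0[of 0 1] B0[of 1 "-1"]
    by (auto simp: matrix_vector_mult_diff_distrib matrix_vector_right_distrib)
  show "\<not> affine_dependent {c, B *v e1 + c, B *v e2 + c}"
  proof
    assume "affine_dependent {c, B *v e1 + c, B *v e2 + c}"
    then obtain U where U: "sum U {c, B *v e1 + c, B *v e2 + c} = 0"
      "\<exists>v\<in>{c, B *v e1 + c, B *v e2 + c}. U v \<noteq> 0"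
      "(\<Sum>v\<in>{c, B *v e1 + c, B *v e2 + c}. U v *\<^sub>R v) = 0"
      by (auto simp: affine_dependent_explicit_finite)
    have s: "U c + U (B *v e1 + c) + U (B *v e2 + c) = 0"
      using U(1) dist by (simp add: add.assoc)
    have "(U c + U (B *v e1 + c) + U (B *v e2 + c)) *\<^sub>R c
        + B *v (U (B *v e1 + c) *\<^sub>R e1 + U (B *v e2 + c) *\<^sub>R e2) = 0"
      using U(3) dist by (simp add: algebra_simps matrix_vector_right_distrib matrix_vector_mult_scaleR)
    then have "U (B *v e1 + c) = 0 \<and> U (B *v e2 + c) = 0" using s B0 by simp
    then show False using s U(2) by auto
  qed
qed

lemma affine_element_hull:
  "affine_element B c K \<Longrightarrow> K = convex hull {c, B *v e1 + c, B *v e2 + c}"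
proof -
  have shift: "(\<lambda>y. B *v y + c) ` S = (\<lambda>x. c + x) ` ((\<lambda>y. B *v y) ` S)" for S :: "pt set"
    by (auto simp: image_image add.commute)
  have "(\<lambda>y. B *v y + c) ` (convex hull S) = convex hull ((\<lambda>y. B *v y + c) ` S)" for S
    unfolding shift convex_hull_translation convex_hull_linear_image[OF matrix_vector_mul_linear] ..
  then show "affine_element B c K \<Longrightarrow> ?thesis"
    unfolding affine_element_def ref_tri_def by simp
qed

lemma verts_affine_element:
  "affine_element B c K \<Longrightarrow> verts K = {c, B *v e1 + c, B *v e2 + c}"
proof -
  assume K: "affine_element B c K"
  then have "invertible B" by (simp add: affine_element_def)
  then show ?thesis
    unfolding verts_def affine_element_hull[OF K]
    using extreme_point_of_convex_hull_affine_independent[OF affine_image_ref_vertices(1)] by auto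
qed

lemma compact_ref_tri: "compact ref_tri"
  unfolding ref_tri_def by (rule finite_imp_compact_convex_hull) simp

lemma affine_element_compact: "affine_element B c K \<Longrightarrow> compact K"
  unfolding affine_element_def
  by (auto intro!: compact_continuous_image compact_ref_tri continuous_intros)

lemma affine_element_convex: "affine_element B c K \<Longrightarrow> convex K"
  by (metis affine_element_hull convex_convex_hull)

lemma affine_element_interior_nonempty: "affine_element B c K \<Longrightarrow> interior K \<noteq> {}"
proof -
  assume K: "affine_element B c K"
  then have B: "invertible B" by (simp add: affine_element_def)
  have "card {c, B *v e1 + c, B *v e2 + c} = Suc DIM(real^2)"
    using affine_image_ref_vertices(2-4)[OF B] by simp
  from interior_convex_hull_eq_empty[OF this] affine_image_ref_vertices(1)[OF B]
  show ?thesis unfolding affine_element_hull[OF K, symmetric] by simp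
qed

lemma bary_affine_element:
  fixes B :: "real^2^2" and c y :: pt
  assumes K: "affine_element B c K"
  defines "l \<equiv> \<lambda>w. if w = c then 1 - y$1 - y$2 else if w = B *v e1 + c then y$1
                    else if w = B *v e2 + c then y$2 else 0"
  shows "bary K w (B *v y + c) = l w"
proof -
  have B: "invertible B" using K by (simp add: affine_element_def)
  note V = verts_affine_element[OF K] and dist = affine_image_ref_vertices(2-4)[OF B]
  define P where "P l' \<longleftrightarrow> (\<forall>w. w \<notin> verts K \<longrightarrow> l' w = 0) \<and> (\<Sum>w\<in>verts K. l' w) = 1 \<and>
                        (\<Sum>w\<in>verts K. l' w *\<^sub>R w) = B *v y + c" for l'
  have "P l"
  proof -
    have "(\<Sum>w\<in>verts K. l w *\<^sub>R w) = B *v (y$1 *\<^sub>R e1 + y$2 *\<^sub>R e2) + c"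
      using dist by (simp add: V l_def algebra_simps matrix_vector_right_distrib matrix_vector_mult_scaleR)
    also have "y$1 *\<^sub>R e1 + y$2 *\<^sub>R e2 = y"
      by (simp add: vec_eq_iff forall_2 axis_def)
    finally show ?thesis unfolding P_def using dist by (auto simp: V l_def)
  qed
  moreover have "l' = l" if "P l'" for l'
  proof
    fix w
    have "\<forall>U. sum U (verts K) = 0 \<longrightarrow> (\<Sum>v\<in>verts K. U v *\<^sub>R v) = 0 \<longrightarrow> (\<forall>v\<in>verts K. U v = 0)"
      using affine_image_ref_vertices(1)[OF B] by (auto simp: V affine_dependent_explicit_finite)
    moreover have "(\<Sum>v\<in>verts K. l' v - l v) = 0" "(\<Sum>v\<in>verts K. (l' v - l v) *\<^sub>R v) = 0"
      using that \<open>P l\<close> unfolding P_def by (simp_all add: sum_subtractf scaleR_diff_left)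
    ultimately have "\<forall>v\<in>verts K. l' v - l v = 0" by blast
    then show "l' w = l w" using that \<open>P l\<close> unfolding P_def by (cases "w \<in> verts K") auto
  qed
  ultimately have "(THE l'. P l') = l" by (rule the_equality)
  then show ?thesis unfolding bary_def P_def by simp
qed

definition ref_bubble :: "pt \<Rightarrow> real" where
  "ref_bubble y = (1 - y$1 - y$2) * y$1 * y$2"

lemma bubble_affine_element:
  assumes K: "affine_element B c K"
  shows "bubble K (B *v y + c) = ref_bubble y"
proof -
  have B: "invertible B" using K by (simp add: affine_element_def)
  note dist = affine_image_ref_vertices(2-4)[OF B]
  show ?thesis
    using dist unfolding bubble_def verts_affine_element[OF K]
    by (simp add: bary_affine_element[OF K] ref_bubble_def mult.assoc)
qed

lemma bubble_ref_coords:
  "affine_element B c K \<Longrightarrow> bubble K x = ref_bubble (ref_coords B c x)"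
  using bubble_affine_element[of B c K "ref_coords B c x"] affine_ref_coords[of B c x]
  by (simp add: affine_element_def)

lemma poly2_ref_coords_comp:
  assumes "f \<in> poly2 n"
  shows "(\<lambda>x. f (ref_coords B c x)) \<in> poly2 n"
  using poly2_affine_comp[OF assms, of "matrix_inv B" "- (matrix_inv B *v c)"]
  by (simp add: ref_coords_def matrix_vector_mult_diff_distrib)

lemma ref_bubble_poly2: "ref_bubble \<in> poly2 3"
proof -
  have "(\<lambda>y::pt. (1 + (-1) * (y$1 ^ 1 * y$2 ^ 0) + (-1) * (y$1 ^ 0 * y$2 ^ 1))
                * (y$1 ^ 1 * y$2 ^ 0) * (y$1 ^ 0 * y$2 ^ 1)) \<in> poly2 (1 + 1 + 1)"
    by (intro poly2_mult poly2_add poly2_const poly2_scale poly2_monomial) auto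
  then show ?thesis by (simp add: ref_bubble_def[abs_def] numeral_3_eq_3)
qed

lemma bubble_poly2: "affine_element B c K \<Longrightarrow> bubble K \<in> poly2 3"
  using poly2_ref_coords_comp[OF ref_bubble_poly2, of B c] bubble_ref_coords[of B c K]
  by (metis (no_types) ext)

section \<open>Local spaces and Lagrange bases\<close>

definition ref_Pkk :: "nat \<Rightarrow> nat \<Rightarrow> (pt \<Rightarrow> real) set" where
  "ref_Pkk k k' = {(\<lambda>y. p y + ref_bubble y * q y) | p q. p \<in> poly2 k \<and> q \<in> poly2 (k' - 3)}"

lemma PkkI:
  "p \<in> poly2 k \<Longrightarrow> q \<in> poly2 (k' - 3) \<Longrightarrow> (\<And>x. f x = p x + bubble K x * q x) \<Longrightarrow> f \<in> Pkk k k' K"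
  unfolding Pkk_def by (rule CollectI, rule exI[of _ p], rule exI[of _ q]) auto

lemma ref_PkkI:
  "p \<in> poly2 k \<Longrightarrow> q \<in> poly2 (k' - 3) \<Longrightarrow> (\<And>y. f y = p y + ref_bubble y * q y) \<Longrightarrow> f \<in> ref_Pkk k k'"
  unfolding ref_Pkk_def by (rule CollectI, rule exI[of _ p], rule exI[of _ q]) auto

lemma Pkk_subset_poly2:
  assumes K: "affine_element B c K" and "3 \<le> k'" "k \<le> k'"
  shows "Pkk k k' K \<subseteq> poly2 k'"
proof
  fix f assume "f \<in> Pkk k k' K"
  then obtain p q where f: "f = (\<lambda>x. p x + bubble K x * q x)"
    and p: "p \<in> poly2 k" and q: "q \<in> poly2 (k' - 3)"
    unfolding Pkk_def by blast
  have "(\<lambda>x. bubble K x * q x) \<in> poly2 (3 + (k' - 3))"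
    by (rule poly2_mult[OF bubble_poly2[OF K] q])
  then show "f \<in> poly2 k'"
    unfolding f using assms(2,3) by (intro poly2_add poly2_mono[OF p]) simp_all
qed

lemma Pkk_affine_comp:
  assumes K: "affine_element B c K" and "f \<in> Pkk k k' K"
  shows "(\<lambda>y. f (B *v y + c)) \<in> ref_Pkk k k'"
proof -
  obtain p q where f: "f = (\<lambda>x. p x + bubble K x * q x)"
    and p: "p \<in> poly2 k" and q: "q \<in> poly2 (k' - 3)"
    using assms(2) unfolding Pkk_def by blast
  show ?thesis
    by (rule ref_PkkI[OF poly2_affine_comp[OF p] poly2_affine_comp[OF q]])
      (simp add: f bubble_affine_element[OF K])
qed

lemma ref_Pkk_ref_coords_comp:
  assumes K: "affine_element B c K" and "g \<in> ref_Pkk k k'"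
  shows "(\<lambda>x. g (ref_coords B c x)) \<in> Pkk k k' K"
proof -
  obtain p q where g: "g = (\<lambda>y. p y + ref_bubble y * q y)"
    and p: "p \<in> poly2 k" and q: "q \<in> poly2 (k' - 3)"
    using assms(2) unfolding ref_Pkk_def by blast
  show ?thesis
    by (rule PkkI[OF poly2_ref_coords_comp[OF p] poly2_ref_coords_comp[OF q]])
      (simp add: g bubble_ref_coords[OF K])
qed

lemma ref_Pkk_zero: "(\<lambda>y. 0) \<in> ref_Pkk k k'"
  by (rule ref_PkkI[OF poly2_zero poly2_zero]) simp

lemma ref_Pkk_add:
  assumes "f \<in> ref_Pkk k k'" "g \<in> ref_Pkk k k'"
  shows "(\<lambda>y. f y + g y) \<in> ref_Pkk k k'"
proof -
  obtain p q p' q' where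
    "f = (\<lambda>y. p y + ref_bubble y * q y)" "p \<in> poly2 k" "q \<in> poly2 (k' - 3)"
    "g = (\<lambda>y. p' y + ref_bubble y * q' y)" "p' \<in> poly2 k" "q' \<in> poly2 (k' - 3)"
    using assms unfolding ref_Pkk_def by blast
  then show ?thesis
    by (intro ref_PkkI[OF poly2_add poly2_add]) (simp_all add: algebra_simps)
qed

lemma ref_Pkk_scale:
  assumes "f \<in> ref_Pkk k k'"
  shows "(\<lambda>y. a * f y) \<in> ref_Pkk k k'"
proof -
  obtain p q where "f = (\<lambda>y. p y + ref_bubble y * q y)" "p \<in> poly2 k" "q \<in> poly2 (k' - 3)"
    using assms unfolding ref_Pkk_def by blast
  then show ?thesis
    by (intro ref_PkkI[OF poly2_scale poly2_scale]) (simp_all add: algebra_simps)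
qed

lemma unisolvent_eqI:
  assumes "unisolvent V nd r" "p \<in> V" "q \<in> V" "\<forall>i<r. p (nd i) = q (nd i)"
  shows "p = q"
proof -
  have "\<exists>!f. f \<in> V \<and> (\<forall>i<r. f (nd i) = q (nd i))"
    using assms(1) unfolding unisolvent_def by (rule spec)
  then show ?thesis using assms(2-4) by blast
qed

lemma unisolvent_ref_Pkk:
  assumes K: "affine_element B c K"
    and uni: "unisolvent (Pkk k k' K) (\<lambda>i. B *v nd i + c) r"
  shows "unisolvent (ref_Pkk k k') nd r"
  unfolding unisolvent_def
proof
  fix d
  have B: "invertible B" using K by (simp add: affine_element_def)
  obtain f where f: "f \<in> Pkk k k' K" "\<forall>i<r. f (B *v nd i + c) = d i"
    using spec[OF uni[unfolded unisolvent_def], of d] by blast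
  show "\<exists>!p. p \<in> ref_Pkk k k' \<and> (\<forall>i<r. p (nd i) = d i)"
  proof
    show "(\<lambda>y. f (B *v y + c)) \<in> ref_Pkk k k' \<and> (\<forall>i<r. f (B *v nd i + c) = d i)"
      using Pkk_affine_comp[OF K f(1)] f(2) by blast
  next
    fix p assume p: "p \<in> ref_Pkk k k' \<and> (\<forall>i<r. p (nd i) = d i)"
    have "(\<lambda>x. p (ref_coords B c x)) = f"
      using p f(2) ref_coords_affine[OF B]
      by (intro unisolvent_eqI[OF uni ref_Pkk_ref_coords_comp[OF K] f(1)]) simp_all
    then show "p = (\<lambda>y. f (B *v y + c))"
      using ref_coords_affine[OF B] by auto
  qed
qed

definition lagrange_basis :: "(pt \<Rightarrow> real) set \<Rightarrow> (nat \<Rightarrow> pt) \<Rightarrow> nat \<Rightarrow> nat \<Rightarrow> pt \<Rightarrow> real" where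
  "lagrange_basis V nd r i = (THE p. p \<in> V \<and> (\<forall>j<r. p (nd j) = (if j = i then 1 else 0)))"

lemma lagrange_basis:
  assumes "unisolvent V nd r"
  shows "lagrange_basis V nd r i \<in> V"
    and "j < r \<Longrightarrow> lagrange_basis V nd r i (nd j) = (if j = i then 1 else 0)"
proof -
  have "\<exists>!p. p \<in> V \<and> (\<forall>j<r. p (nd j) = (if j = i then 1 else 0))"
    using assms unfolding unisolvent_def by (rule spec)
  from theI'[OF this] show "lagrange_basis V nd r i \<in> V"
    and "j < r \<Longrightarrow> lagrange_basis V nd r i (nd j) = (if j = i then 1 else 0)"
    unfolding lagrange_basis_def by auto
qed

lemma lagrange_expansion:
  assumes uni: "unisolvent V nd r" and p: "p \<in> V"
    and zero: "(\<lambda>x. 0) \<in> V"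
    and add: "\<And>f g. f \<in> V \<Longrightarrow> g \<in> V \<Longrightarrow> (\<lambda>x. f x + g x) \<in> V"
    and scale: "\<And>f a. f \<in> V \<Longrightarrow> (\<lambda>x. a * f x) \<in> V"
  shows "p = (\<lambda>x. \<Sum>j<r. p (nd j) * lagrange_basis V nd r j x)"
proof (rule unisolvent_eqI[OF uni p])
  have "finite A \<Longrightarrow> (\<lambda>x. \<Sum>j\<in>A. p (nd j) * lagrange_basis V nd r j x) \<in> V" for A
  proof (induction A rule: finite_induct)
    case (insert j A)
    then show ?case
      using add[OF scale[OF lagrange_basis(1)[OF uni]] insert.IH] by simp
  qed (simp add: zero)
  then show "(\<lambda>x. \<Sum>j<r. p (nd j) * lagrange_basis V nd r j x) \<in> V" by simp
  show "\<forall>i<r. p (nd i) = (\<Sum>j<r. p (nd j) * lagrange_basis V nd r j (nd i))"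
  proof (intro allI impI)
    fix i assume i: "i < r"
    have "(\<Sum>j<r. p (nd j) * lagrange_basis V nd r j (nd i)) = (\<Sum>j<r. if j = i then p (nd i) else 0)"
      by (rule sum.cong) (auto simp: lagrange_basis(2)[OF uni i])
    then show "p (nd i) = (\<Sum>j<r. p (nd j) * lagrange_basis V nd r j (nd i))"
      using i by simp
  qed
qed

section \<open>Lumped quadrature on one element\<close>

lemma continuous_on_compact_absolutely_integrable:
  fixes f :: "pt \<Rightarrow> 'b::euclidean_space"
  assumes "compact S" "continuous_on S f"
  shows "f absolutely_integrable_on S"
  using borel_integrable_compact[OF assms] unfolding set_integrable_def
  by (simp add: integrable_completion borel_measurable_integrable)

lemma continuous_on_compact_integrable:
  fixes f :: "pt \<Rightarrow> real"
  assumes "compact S" "continuous_on S f"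
  shows "f integrable_on S"
  using continuous_on_compact_absolutely_integrable[OF assms]
  by (simp add: absolutely_integrable_on_def)

lemma integral_affine_image:
  fixes B :: "real^2^2" and h :: "pt \<Rightarrow> real"
  assumes B: "invertible B" and S: "compact S" and h: "continuous_on UNIV h"
  shows "integral ((\<lambda>y. B *v y + c) ` S) h = \<bar>det B\<bar> * integral S (\<lambda>y. h (B *v y + c))"
proof -
  let ?F = "\<lambda>y. B *v y + c"
  \<comment> \<open>The change of variables theorem is stated for integrands with values in \<open>real^'n\<close>.\<close>
  let ?lift = "\<lambda>t::real. t *\<^sub>R (1::real^1)"
  have lift: "f integrable_on T \<Longrightarrow> integral T (\<lambda>x. ?lift (f x)) = ?lift (integral T f)"
    for f :: "pt \<Rightarrow> real" and T
    using integral_linear[OF _ bounded_linear_scaleR_left, of f T 1] by (simp add: o_def)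
  have FS: "compact (?F ` S)"
    by (intro compact_continuous_image S continuous_intros)
  have hF: "continuous_on S (\<lambda>y. h (B *v y + c))"
    by (intro continuous_on_compose2[OF h] continuous_intros) auto
  have cov: "integral (?F ` S) (\<lambda>x. ?lift (h x))
      = integral S (\<lambda>y. \<bar>det (matrix ((*v) B))\<bar> *\<^sub>R ?lift (h (?F y)))"
  proof (rule integral_change_of_variables)
    show "S \<in> sets lebesgue" using S by (simp add: compact_imp_closed borel_closed)
    show "(?F has_derivative (*v) B) (at y within S)" for y
      by (simp add: bounded_linear_imp_has_derivative has_derivative_add_const)
    show "inj_on ?F S"
      by (rule inj_onI) (metis B ref_coords_affine)
    have "(\<lambda>x. ?lift (h x)) absolutely_integrable_on ?F ` S"
      by (intro continuous_on_compact_absolutely_integrable FS continuous_intros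
          continuous_on_subset[OF h]) auto
    then show "(\<lambda>x. ?lift (h x)) absolutely_integrable_on ?F ` S \<or>
        (\<lambda>y. \<bar>det (matrix ((*v) B))\<bar> *\<^sub>R ?lift (h (?F y))) absolutely_integrable_on S" ..
  qed
  have "?lift (integral (?F ` S) h) = integral (?F ` S) (\<lambda>x. ?lift (h x))"
    by (rule lift[OF continuous_on_compact_integrable[OF FS continuous_on_subset[OF h subset_UNIV]], symmetric])
  also have "\<dots> = \<bar>det B\<bar> *\<^sub>R integral S (\<lambda>y. ?lift (h (?F y)))"
    unfolding cov matrix_of_matrix_vector_mul by (rule integral_cmul)
  also have "\<dots> = ?lift (\<bar>det B\<bar> * integral S (\<lambda>y. h (?F y)))"
    by (simp only: lift[OF continuous_on_compact_integrable[OF S hF]] scaleR_scaleR)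
  finally have "?lift (integral (?F ` S) h) = ?lift (\<bar>det B\<bar> * integral S (\<lambda>y. h (?F y)))" .
  then show ?thesis by (simp add: scaleR_cancel_right)
qed

definition lumping_const :: "pt set \<Rightarrow> (pt \<Rightarrow> real) set \<Rightarrow> (nat \<Rightarrow> pt) \<Rightarrow> nat \<Rightarrow> real" where
  "lumping_const S V nd r = 1 + real r *
     (\<Sum>j<r. \<bar>integral S (\<lambda>y. (lagrange_basis V nd r j y)\<^sup>2) / integral S (lagrange_basis V nd r j)\<bar>)"

lemma lumping_const_pos: "lumping_const S V nd r > 0"
  unfolding lumping_const_def by (simp add: add_pos_nonneg sum_nonneg)

lemma lagrange_lumping_estimate:
  assumes uni: "unisolvent V nd r" and p: "p \<in> V"
    and zero: "(\<lambda>x. 0) \<in> V"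
    and add: "\<And>f g. f \<in> V \<Longrightarrow> g \<in> V \<Longrightarrow> (\<lambda>x. f x + g x) \<in> V"
    and scale: "\<And>f a. f \<in> V \<Longrightarrow> (\<lambda>x. a * f x) \<in> V"
    and cont: "\<And>f. f \<in> V \<Longrightarrow> continuous_on S f" and S: "compact S"
    and mass_pos: "\<And>j. j < r \<Longrightarrow> integral S (lagrange_basis V nd r j) > 0"
  shows "integral S (\<lambda>y. (p y)\<^sup>2)
    \<le> lumping_const S V nd r * (\<Sum>j<r. integral S (lagrange_basis V nd r j) * (p (nd j))\<^sup>2)"
proof -
  define \<phi> where "\<phi> = lagrange_basis V nd r"
  define a where "a j = integral S (\<phi> j)" for j
  define b where "b j = integral S (\<lambda>y. (\<phi> j y)\<^sup>2)" for j
  define R where "R = (\<Sum>j<r. \<bar>b j / a j\<bar>)"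
  have \<phi>c: "continuous_on S (\<phi> j)" for j
    unfolding \<phi>_def by (rule cont[OF lagrange_basis(1)[OF uni]])
  have int: "(\<lambda>y. (p (nd j))\<^sup>2 * (\<phi> j y)\<^sup>2) integrable_on S" for j
    by (intro continuous_on_compact_integrable S continuous_intros \<phi>c)
  have b_le: "b j \<le> R * a j" if "j < r" for j
  proof -
    have "b j = b j / a j * a j" using mass_pos[OF that] by (simp add: a_def \<phi>_def)
    also have "\<dots> \<le> R * a j"
    proof (rule mult_right_mono)
      have "b j / a j \<le> \<bar>b j / a j\<bar>" by (rule abs_ge_self)
      also have "\<dots> \<le> R" unfolding R_def using that by (intro member_le_sum) auto
      finally show "b j / a j \<le> R" .
    qed (use mass_pos[OF that] in \<open>simp add: a_def \<phi>_def\<close>)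
    finally show ?thesis .
  qed
  have "(p y)\<^sup>2 \<le> real r * (\<Sum>j<r. (p (nd j))\<^sup>2 * (\<phi> j y)\<^sup>2)" for y
  proof -
    have "(p y)\<^sup>2 = (\<Sum>j<r. p (nd j) * \<phi> j y)\<^sup>2"
      by (subst lagrange_expansion[OF uni p zero add scale]) (simp_all add: \<phi>_def)
    also have "\<dots> \<le> (\<Sum>j<r. (p (nd j) * \<phi> j y)\<^sup>2) * card {..<r}"
      by (rule sum_squared_le_sum_of_squares)
    finally show ?thesis by (simp add: power_mult_distrib mult.commute)
  qed
  then have "integral S (\<lambda>y. (p y)\<^sup>2) \<le> integral S (\<lambda>y. real r * (\<Sum>j<r. (p (nd j))\<^sup>2 * (\<phi> j y)\<^sup>2))"
    using \<phi>c cont[OF p]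
    by (intro integral_le continuous_on_compact_integrable S continuous_intros) auto
  also have "\<dots> = real r * (\<Sum>j<r. (p (nd j))\<^sup>2 * b j)"
    using int by (simp add: integral_sum b_def)
  also have "\<dots> \<le> real r * (\<Sum>j<r. (p (nd j))\<^sup>2 * (R * a j))"
    using b_le by (intro mult_left_mono sum_mono) auto
  also have "\<dots> = real r * R * (\<Sum>j<r. a j * (p (nd j))\<^sup>2)"
    by (simp add: sum_distrib_left mult_ac)
  also have "\<dots> \<le> lumping_const S V nd r * (\<Sum>j<r. a j * (p (nd j))\<^sup>2)"
  proof (rule mult_right_mono)
    show "0 \<le> (\<Sum>j<r. a j * (p (nd j))\<^sup>2)"
      using mass_pos by (intro sum_nonneg) (simp add: a_def \<phi>_def less_imp_le)
  qed (simp add: lumping_const_def R_def b_def a_def \<phi>_def)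
  finally show ?thesis by (simp add: a_def \<phi>_def)
qed

lemma ref_Pkk_continuous:
  assumes "f \<in> ref_Pkk k k'"
  shows "continuous_on S f"
proof -
  obtain p q where f: "f = (\<lambda>y. p y + ref_bubble y * q y)"
    and p: "p \<in> poly2 k" and q: "q \<in> poly2 (k' - 3)"
    using assms unfolding ref_Pkk_def by blast
  have "continuous_on UNIV f"
    unfolding f
    by (intro continuous_on_add continuous_on_mult poly2_continuous[OF p] poly2_continuous[OF q]
        poly2_continuous[OF ref_bubble_poly2])
  then show ?thesis by (rule continuous_on_subset) simp
qed

lemma Pkk_continuous:
  assumes "affine_element B c K" "3 \<le> k'" "k \<le> k'" "f \<in> Pkk k k' K"
  shows "continuous_on S f"
  using poly2_continuous Pkk_subset_poly2[OF assms(1-3)] assms(4)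
  by (blast intro: continuous_on_subset)

lemma quadrature_weight_affine_element:
  assumes K: "affine_element B c K"
    and uni: "unisolvent (Pkk k k' K) (\<lambda>i. B *v xh i + c) r"
    and exact: "\<forall>g\<in>poly2 (k + k' - 2). (\<Sum>i<r. w i * g (B *v xh i + c)) = integral K g"
    and deg: "2 \<le> k" "k \<le> k'" "3 \<le> k'" and j: "j < r"
  shows "w j = \<bar>det B\<bar> * integral ref_tri (lagrange_basis (ref_Pkk k k') xh r j)"
proof -
  have B: "invertible B" and K_eq: "K = (\<lambda>y. B *v y + c) ` ref_tri"
    using K by (auto simp: affine_element_def)
  note runi = unisolvent_ref_Pkk[OF K uni]
  define \<phi> where "\<phi> = lagrange_basis (ref_Pkk k k') xh r j"
  define g where "g x = \<phi> (ref_coords B c x)" for x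
  have "g \<in> Pkk k k' K"
    unfolding g_def \<phi>_def by (rule ref_Pkk_ref_coords_comp[OF K lagrange_basis(1)[OF runi]])
  then have "g \<in> poly2 k'" using Pkk_subset_poly2[OF K deg(3,2)] by blast
  then have g: "g \<in> poly2 (k + k' - 2)" by (rule poly2_mono) (use deg in simp)
  have "(\<Sum>i<r. w i * g (B *v xh i + c)) = (\<Sum>i<r. if i = j then w j else 0)"
    by (rule sum.cong) (auto simp: g_def \<phi>_def ref_coords_affine[OF B] lagrange_basis(2)[OF runi])
  then have "w j = (\<Sum>i<r. w i * g (B *v xh i + c))" using j by simp
  also have "\<dots> = integral K g" using exact g by blast
  also have "\<dots> = \<bar>det B\<bar> * integral ref_tri \<phi>"
    unfolding K_eq using poly2_continuous[OF g]
    by (simp add: integral_affine_image[OF B compact_ref_tri] g_def ref_coords_affine[OF B])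
  finally show ?thesis unfolding \<phi>_def .
qed

lemma element_lumping_estimate:
  assumes K: "affine_element B c K"
    and uni: "unisolvent (Pkk k k' K) (\<lambda>i. B *v xh i + c) r"
    and exact: "\<forall>g\<in>poly2 (k + k' - 2). (\<Sum>i<r. w i * g (B *v xh i + c)) = integral K g"
    and w_pos: "\<forall>i<r. w i > 0"
    and deg: "2 \<le> k" "k \<le> k'" "3 \<le> k'" and p: "p \<in> Pkk k k' K"
  shows "integral K (\<lambda>x. (p x)\<^sup>2)
    \<le> lumping_const ref_tri (ref_Pkk k k') xh r * (\<Sum>i<r. w i * (p (B *v xh i + c))\<^sup>2)"
proof -
  have B: "invertible B" and K_eq: "K = (\<lambda>y. B *v y + c) ` ref_tri"
    using K by (auto simp: affine_element_def)
  note runi = unisolvent_ref_Pkk[OF K uni]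
  note weight = quadrature_weight_affine_element[OF K uni exact deg]
  define D where "D = lumping_const ref_tri (ref_Pkk k k') xh r"
  define a where "a j = integral ref_tri (lagrange_basis (ref_Pkk k k') xh r j)" for j
  have a_pos: "a j > 0" if "j < r" for j
    using w_pos weight[OF that] that by (auto simp: a_def zero_less_mult_iff)
  have "integral K (\<lambda>x. (p x)\<^sup>2) = \<bar>det B\<bar> * integral ref_tri (\<lambda>y. (p (B *v y + c))\<^sup>2)"
    unfolding K_eq
    by (intro integral_affine_image[OF B compact_ref_tri] continuous_intros
        Pkk_continuous[OF K deg(3,2) p])
  also have "\<dots> \<le> \<bar>det B\<bar> * (D * (\<Sum>j<r. a j * (p (B *v xh j + c))\<^sup>2))"
  proof (rule mult_left_mono[OF _ abs_ge_zero])
    show "integral ref_tri (\<lambda>y. (p (B *v y + c))\<^sup>2) \<le> D * (\<Sum>j<r. a j * (p (B *v xh j + c))\<^sup>2)"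
      unfolding D_def a_def
      by (rule lagrange_lumping_estimate[OF runi Pkk_affine_comp[OF K p] ref_Pkk_zero])
        (auto intro: ref_Pkk_add ref_Pkk_scale ref_Pkk_continuous compact_ref_tri a_pos[unfolded a_def])
  qed
  also have "\<dots> = D * (\<Sum>j<r. w j * (p (B *v xh j + c))\<^sup>2)"
    using weight by (simp add: a_def sum_distrib_left mult_ac)
  finally show ?thesis unfolding D_def .
qed

section \<open>Coercivity\<close>

lemma frob_self: "frob X X = (\<Sum>a\<in>UNIV. \<Sum>b\<in>UNIV. (X$a$b)\<^sup>2)"
  unfolding frob_def by (simp add: power2_eq_square)

lemma frob_self_nonneg: "0 \<le> frob X X"
  unfolding frob_self by (intro sum_nonneg) auto

lemma frob_scaleR_left: "frob (u *\<^sub>R Y) X = u * frob Y X"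
  unfolding frob_def by (simp add: sum_distrib_left mult.assoc)

lemma frob_diff_left: "frob (Y - Z) X = frob Y X - frob Z X"
  unfolding frob_def by (simp add: sum_subtractf left_diff_distrib)

lemma frob_mat1_left: "frob (mat 1) X = tr2 X"
  unfolding frob_def tr2_def by (simp add: sum_2 mat_def)

lemma tr2_square_le: "(tr2 X)\<^sup>2 \<le> 2 * frob X X"
proof -
  have "2 * frob X X - (tr2 X)\<^sup>2 = (X$1$1 - X$2$2)\<^sup>2 + 2 * (X$1$2)\<^sup>2 + 2 * (X$2$1)\<^sup>2"
    by (simp add: frob_def tr2_def sum_2 power2_eq_square algebra_simps)
  then show ?thesis by (smt (verit) zero_le_power2)
qed

lemma Acomp_coercive:
  assumes lam: "lam > 0" and mu: "mu > 0"
  shows "frob X X \<le> 2 * (mu + lam) * frob (Acomp lam mu X) X"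
proof -
  define s where "s = lam / (2 * mu + 2 * lam)"
  have "1 - 2 * s = mu / (mu + lam)"
    using lam mu by (simp add: s_def field_simps)
  then have "frob X X = 2 * (mu + lam) * ((1 - 2 * s) * frob X X / (2 * mu))"
    using lam mu by (simp only:) (simp add: divide_simps)
  also have "\<dots> \<le> 2 * (mu + lam) * ((frob X X - s * (tr2 X)\<^sup>2) / (2 * mu))"
    using mult_left_mono[OF tr2_square_le, of s X] lam mu
    by (intro mult_left_mono divide_right_mono) (simp_all add: s_def algebra_simps)
  also have "\<dots> = 2 * (mu + lam) * frob (Acomp lam mu X) X"
    by (simp add: Acomp_def frob_scaleR_left frob_diff_left frob_mat1_left s_def power2_eq_square)
  finally show ?thesis .
qed

lemma elem_val_affine_element:
  fixes P \<tau> :: "pt \<Rightarrow> mat2"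
  assumes K: "affine_element B c K" and eq: "\<forall>x\<in>interior K. \<tau> x = P x"
    and P: "continuous_on UNIV P" and x: "x \<in> K"
  shows "elem_val K \<tau> x = P x"
proof -
  have "closure (interior K) = K"
    using convex_closure_interior[OF affine_element_convex[OF K] affine_element_interior_nonempty[OF K]]
      compact_imp_closed[OF affine_element_compact[OF K]]
    by simp
  then have "x islimpt closure (interior K)"
    using x by (intro islimpt_closure_open[OF open_interior refl]) simp
  then have "x islimpt interior K" by (simp add: limpt_of_closure)
  then have nontriv: "\<not> trivial_limit (at x within interior K)"
    by (simp add: trivial_limit_within)
  have "(P \<longlongrightarrow> P x) (at x within interior K)"
    using P by (meson UNIV_I continuous_on_def subset_UNIV tendsto_within_subset)
  moreover have "eventually (\<lambda>y. \<tau> y = P y) (at x within interior K)"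
    unfolding eventually_at_filter by (rule always_eventually) (simp add: eq)
  ultimately have "(\<tau> \<longlongrightarrow> P x) (at x within interior K)" using tendsto_cong by blast
  then show ?thesis unfolding elem_val_def by (rule tendsto_Lim[OF nontriv])
qed

lemma integral_frob_lumping_estimate:
  fixes P :: "pt \<Rightarrow> mat2"
  assumes K: "affine_element B c K"
    and uni: "unisolvent (Pkk k k' K) (\<lambda>i. B *v xh i + c) r"
    and exact: "\<forall>g\<in>poly2 (k + k' - 2). (\<Sum>i<r. w i * g (B *v xh i + c)) = integral K g"
    and w_pos: "\<forall>i<r. w i > 0"
    and deg: "2 \<le> k" "k \<le> k'" "3 \<le> k'" and P: "\<And>a b. (\<lambda>x. P x $ a $ b) \<in> Pkk k k' K"
  shows "integral K (\<lambda>x. frob (P x) (P x))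
    \<le> lumping_const ref_tri (ref_Pkk k k') xh r * (\<Sum>i<r. w i * frob (P (B *v xh i + c)) (P (B *v xh i + c)))"
proof -
  define D where "D = lumping_const ref_tri (ref_Pkk k k') xh r"
  have int: "(\<lambda>x. (P x $ a $ b)\<^sup>2) integrable_on K" for a b
    by (intro continuous_on_compact_integrable affine_element_compact[OF K] continuous_intros
        Pkk_continuous[OF K deg(3,2) P])
  have "integral K (\<lambda>x. frob (P x) (P x)) = (\<Sum>a\<in>UNIV. \<Sum>b\<in>UNIV. integral K (\<lambda>x. (P x $ a $ b)\<^sup>2))"
    unfolding frob_self using int by (simp add: integral_sum integrable_sum)
  also have "\<dots> \<le> (\<Sum>a\<in>UNIV. \<Sum>b\<in>UNIV. D * (\<Sum>i<r. w i * (P (B *v xh i + c) $ a $ b)\<^sup>2))"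
    unfolding D_def by (intro sum_mono element_lumping_estimate[OF K uni exact w_pos deg P])
  also have "\<dots> = D * (\<Sum>i<r. w i * frob (P (B *v xh i + c)) (P (B *v xh i + c)))"
    by (simp add: frob_self sum_distrib_left sum.swap[of _ UNIV "{..<r}"] mult.assoc)
  finally show ?thesis unfolding D_def .
qed

lemma element_coercivity:
  fixes P \<tau> :: "pt \<Rightarrow> mat2"
  assumes lam: "lam > 0" and mu: "mu > 0"
    and K: "affine_element B c K"
    and uni: "unisolvent (Pkk k k' K) (\<lambda>i. B *v xh i + c) r"
    and exact: "\<forall>g\<in>poly2 (k + k' - 2). (\<Sum>i<r. w i * g (B *v xh i + c)) = integral K g"
    and w_pos: "\<forall>i<r. w i > 0" and nodes: "\<forall>i<r. xh i \<in> ref_tri"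
    and deg: "2 \<le> k" "k \<le> k'" "3 \<le> k'"
    and eq: "\<forall>x\<in>interior K. \<tau> x = P x" and P: "\<And>a b. (\<lambda>x. P x $ a $ b) \<in> Pkk k k' K"
  shows "integral K (\<lambda>x. frob (P x) (P x))
    \<le> 2 * (mu + lam) * lumping_const ref_tri (ref_Pkk k k') xh r *
       (\<Sum>i<r. w i * frob (Acomp lam mu (elem_val K \<tau> (B *v xh i + c))) (elem_val K \<tau> (B *v xh i + c)))"
proof -
  define D where "D = lumping_const ref_tri (ref_Pkk k k') xh r"
  have "continuous_on UNIV (\<lambda>x. \<chi> a. \<chi> b. P x $ a $ b)"
    by (intro continuous_on_vec_lambda Pkk_continuous[OF K deg(3,2) P])
  then have "elem_val K \<tau> (B *v xh i + c) = P (B *v xh i + c)" if "i < r" for i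
    using nodes that K by (intro elem_val_affine_element[OF K eq]) (auto simp: affine_element_def)
  then have "(\<Sum>i<r. w i * frob (P (B *v xh i + c)) (P (B *v xh i + c)))
      \<le> 2 * (mu + lam) * (\<Sum>i<r. w i * frob (Acomp lam mu (elem_val K \<tau> (B *v xh i + c))) (elem_val K \<tau> (B *v xh i + c)))"
    using w_pos Acomp_coercive[OF lam mu]
    by (auto simp: sum_distrib_left mult.left_commute intro!: sum_mono mult_left_mono)
  then have "D * (\<Sum>i<r. w i * frob (P (B *v xh i + c)) (P (B *v xh i + c)))
      \<le> D * (2 * (mu + lam) * (\<Sum>i<r. w i * frob (Acomp lam mu (elem_val K \<tau> (B *v xh i + c))) (elem_val K \<tau> (B *v xh i + c))))"
    by (rule mult_left_mono) (simp add: D_def lumping_const_pos less_imp_le)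
  then show ?thesis
    using integral_frob_lumping_estimate[OF K uni exact w_pos deg P]
    by (simp add: D_def mult_ac)
qed

section \<open>Assembly over the triangulation\<close>

lemma integral_le_sum_convex_cover:
  fixes f :: "pt \<Rightarrow> real" and h :: "pt set \<Rightarrow> pt \<Rightarrow> real"
  assumes T: "finite T" and cover: "\<Omega> \<subseteq> \<Union>T"
    and K: "\<And>K. K \<in> T \<Longrightarrow> convex K \<and> closed K"
    and h: "\<And>K. K \<in> T \<Longrightarrow> h K integrable_on K" and h_nonneg: "\<And>K x. 0 \<le> h K x"
    and f: "f integrable_on \<Omega>" and f_eq: "\<And>K x. K \<in> T \<Longrightarrow> x \<in> interior K \<Longrightarrow> f x = h K x"
  shows "integral \<Omega> f \<le> (\<Sum>K\<in>T. integral K (h K))"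
proof -
  define N where "N = \<Union>(frontier ` T)"
  define g where "g x = (if x \<in> \<Omega> - N then f x else 0)" for x
  define G where "G x = (\<Sum>K\<in>T. if x \<in> K then h K x else 0)" for x
  have N: "negligible N"
    unfolding N_def using T K by (intro negligible_Union) (auto intro: negligible_convex_frontier)
  have spike: "g x = (if x \<in> \<Omega> then f x else 0)" if "x \<in> UNIV - N" for x
    using that by (simp add: g_def)
  have f_UNIV: "(\<lambda>x. if x \<in> \<Omega> then f x else 0) integrable_on UNIV"
    using f by (simp add: integrable_restrict_UNIV)
  have G: "G integrable_on UNIV"
    unfolding G_def using T h by (intro integrable_sum) (simp_all add: integrable_restrict_UNIV)
  have "g x \<le> G x" for x
  proof (cases "x \<in> \<Omega> - N")
    case True
    then obtain K0 where K0: "K0 \<in> T" "x \<in> K0" using cover by auto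
    then have "x \<in> interior K0"
      using True K[OF K0(1)] unfolding N_def by (auto simp: frontier_def closure_closed)
    then have "g x = (if x \<in> K0 then h K0 x else 0)" using True f_eq[OF K0(1)] K0(2) by (simp add: g_def)
    also have "\<dots> \<le> G x" unfolding G_def by (rule member_le_sum[OF K0(1) _ T]) (simp add: h_nonneg)
    finally show ?thesis .
  qed (auto simp: g_def G_def sum_nonneg h_nonneg)
  then have "integral UNIV g \<le> integral UNIV G"
    by (intro integral_le integrable_spike[OF f_UNIV N spike] G)
  moreover have "integral UNIV (\<lambda>x. if x \<in> \<Omega> then f x else 0) = integral UNIV g"
    by (rule integral_spike[OF N spike])
  then have "integral \<Omega> f = integral UNIV g" by (simp add: integral_restrict_UNIV)
  moreover have "integral UNIV G = (\<Sum>K\<in>T. integral K (h K))"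
    unfolding G_def using T h by (simp add: integral_sum integrable_restrict_UNIV integral_restrict_UNIV)
  ultimately show ?thesis by simp
qed

lemma lebesgue_integral_le_sum_convex_cover:
  fixes f :: "pt \<Rightarrow> real" and h :: "pt set \<Rightarrow> pt \<Rightarrow> real"
  assumes T: "finite T" and cover: "\<Omega> \<subseteq> \<Union>T" and \<Omega>: "\<Omega> \<in> sets lebesgue"
    and K: "\<And>K. K \<in> T \<Longrightarrow> convex K \<and> closed K"
    and h: "\<And>K. K \<in> T \<Longrightarrow> h K integrable_on K" and h_nonneg: "\<And>K x. 0 \<le> h K x"
    and f_eq: "\<And>K x. K \<in> T \<Longrightarrow> x \<in> interior K \<Longrightarrow> f x = h K x"
  shows "integral\<^sup>L (lebesgue_on \<Omega>) f \<le> (\<Sum>K\<in>T. integral K (h K))"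
proof (cases "integrable (lebesgue_on \<Omega>) f")
  case True
  have "(f has_integral integral\<^sup>L (lebesgue_on \<Omega>) f) \<Omega>"
    by (rule has_integral_integral_lebesgue_on[OF True \<Omega>])
  then show ?thesis
    using integral_le_sum_convex_cover[OF T cover K h h_nonneg _ f_eq]
    by (auto simp: integral_unique integrable_on_def)
next
  case False
  then show ?thesis
    using h h_nonneg by (simp add: not_integrable_integral_eq sum_nonneg integral_nonneg)
qed

lemma Sigma_kkh_restrict_Pkk:
  assumes "\<tau> \<in> Sigma_kkh k k' \<Omega> T" "K \<in> T"
  obtains P where "\<forall>x\<in>interior K. \<tau> x = P x" "\<And>a b. (\<lambda>x. P x $ a $ b) \<in> Pkk k k' K"
proof -
  obtain \<sigma>1 \<sigma>2 \<tau>' where \<tau>: "\<tau> = (\<lambda>x. \<sigma>1 x + \<sigma>2 x + \<tau>' x)"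
    and "restr_poly k K \<sigma>1" "restr_poly k K \<sigma>2" "restr_bubble k k' K \<tau>'"
    using assms unfolding Sigma_kkh_def Sigma_kh_def Lambda_kk_def by blast
  then obtain P1 P2 Q where
    P1: "symmat_in (poly2 k) P1" "\<forall>x\<in>interior K. \<sigma>1 x = P1 x" and
    P2: "symmat_in (poly2 k) P2" "\<forall>x\<in>interior K. \<sigma>2 x = P2 x" and
    Q: "symmat_in (homsum2 (k - 2) (k' - 3)) Q" "\<forall>x\<in>interior K. \<tau>' x = bubble K x *\<^sub>R Q x"
    unfolding restr_poly_def restr_bubble_def by metis
  show ?thesis
  proof
    show "\<forall>x\<in>interior K. \<tau> x = P1 x + P2 x + bubble K x *\<^sub>R Q x"
      using P1 P2 Q by (simp add: \<tau>)
    fix a b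
    have "(\<lambda>x. P1 x $ a $ b + P2 x $ a $ b) \<in> poly2 k"
      using P1(1) P2(1) unfolding symmat_in_def by (intro poly2_add) auto
    moreover have "(\<lambda>x. Q x $ a $ b) \<in> poly2 (k' - 3)"
      using Q(1) homsum2_subset_poly2 unfolding symmat_in_def by blast
    ultimately show "(\<lambda>x. (P1 x + P2 x + bubble K x *\<^sub>R Q x) $ a $ b) \<in> Pkk k k' K"
      by (rule PkkI) simp
  qed
qed

lemma lumped_coercive:
  fixes FK :: "pt set \<Rightarrow> pt \<Rightarrow> pt"
  assumes lam: "lam > 0" and mu: "mu > 0" and deg: "2 \<le> k" "k \<le> k'" "3 \<le> k'"
    and \<Omega>: "\<Omega> \<in> sets lebesgue" and T: "finite T" and cover: "\<Omega> \<subseteq> \<Union>T"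
    and nodes: "\<forall>i<r. xh i \<in> ref_tri"
    and affine: "\<forall>K\<in>T. (\<exists>B c. invertible B \<and> (\<forall>x. FK K x = B *v x + c)) \<and> FK K ` ref_tri = K"
    and uni: "\<forall>K\<in>T. unisolvent (Pkk k k' K) (\<lambda>i. FK K (xh i)) r"
    and w_pos: "\<forall>K\<in>T. \<forall>i<r. w K i > 0"
    and exact: "\<forall>K\<in>T. \<forall>g\<in>poly2 (k + k' - 2). (\<Sum>i<r. w K i * g (FK K (xh i))) = integral K g"
    and \<tau>: "\<tau> \<in> Sigma_kkh k k' \<Omega> T"
  shows "L2sq \<Omega> \<tau> \<le> 2 * (mu + lam) * lumping_const ref_tri (ref_Pkk k k') xh r *
           lumped lam mu r w (\<lambda>K i. FK K (xh i)) T \<tau> \<tau>"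
proof -
  define D where "D = lumping_const ref_tri (ref_Pkk k k') xh r"
  have "\<forall>K\<in>T. \<exists>P. (\<forall>x\<in>interior K. \<tau> x = P x) \<and> (\<forall>a b. (\<lambda>x. P x $ a $ b) \<in> Pkk k k' K)"
    using Sigma_kkh_restrict_Pkk[OF \<tau>] by metis
  then obtain P where P: "\<And>K. K \<in> T \<Longrightarrow> \<forall>x\<in>interior K. \<tau> x = P K x"
    "\<And>K a b. K \<in> T \<Longrightarrow> (\<lambda>x. P K x $ a $ b) \<in> Pkk k k' K"
    by metis
  have element: "affine_element B c K \<and> FK K = (\<lambda>x. B *v x + c)" if "K \<in> T" "invertible B"
    "\<forall>x. FK K x = B *v x + c" for K B c
  proof -
    have "FK K = (\<lambda>x. B *v x + c)" using that(3) by auto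
    moreover have "FK K ` ref_tri = K" using affine that(1) by blast
    ultimately show ?thesis by (simp add: affine_element_def that(2))
  qed
  have "L2sq \<Omega> \<tau> \<le> (\<Sum>K\<in>T. integral K (\<lambda>x. frob (P K x) (P K x)))"
    unfolding L2sq_def
  proof (rule lebesgue_integral_le_sum_convex_cover[OF T cover \<Omega>])
    fix K assume K: "K \<in> T"
    then obtain B c where el: "affine_element B c K" using affine element by metis
    show "convex K \<and> closed K"
      using affine_element_convex[OF el] affine_element_compact[OF el] compact_imp_closed by blast
    show "(\<lambda>x. frob (P K x) (P K x)) integrable_on K"
      unfolding frob_self
      by (intro continuous_on_compact_integrable affine_element_compact[OF el] continuous_intros
          Pkk_continuous[OF el deg(3,2) P(2)[OF K]])
  qed (use P(1) frob_self_nonneg in auto)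
  also have "\<dots> \<le> (\<Sum>K\<in>T. 2 * (mu + lam) * D *
      (\<Sum>i<r. w K i * frob (Acomp lam mu (elem_val K \<tau> (FK K (xh i)))) (elem_val K \<tau> (FK K (xh i)))))"
  proof (rule sum_mono)
    fix K assume K: "K \<in> T"
    then obtain B c where el: "affine_element B c K" and FK: "FK K = (\<lambda>x. B *v x + c)"
      using affine element by metis
    have "unisolvent (Pkk k k' K) (\<lambda>i. B *v xh i + c) r"
      "\<forall>g\<in>poly2 (k + k' - 2). (\<Sum>i<r. w K i * g (B *v xh i + c)) = integral K g"
      "\<forall>i<r. w K i > 0"
      using bspec[OF uni K] bspec[OF exact K] bspec[OF w_pos K] by (simp_all add: FK)
    from element_coercivity[OF lam mu el this nodes deg P(1)[OF K] P(2)[OF K]]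
    show "integral K (\<lambda>x. frob (P K x) (P K x)) \<le> 2 * (mu + lam) * D *
      (\<Sum>i<r. w K i * frob (Acomp lam mu (elem_val K \<tau> (FK K (xh i)))) (elem_val K \<tau> (FK K (xh i))))"
      unfolding D_def FK .
  qed
  finally show ?thesis by (simp add: lumped_def D_def sum_distrib_left)
qed

theorem lemma4p2:
  fixes lam mu :: real and k k' r :: nat and \<Omega> :: "pt set" and F :: "pt set set set"
    and xh :: "nat \<Rightarrow> pt"
    and FK :: "pt set set \<Rightarrow> pt set \<Rightarrow> pt \<Rightarrow> pt"
    and w :: "pt set set \<Rightarrow> pt set \<Rightarrow> nat \<Rightarrow> real"
  assumes lam: "lam > 0" and mu: "mu > 0"
    and kk: "3 \<le> k" "k < k'"
    and dom: "polygonal_domain \<Omega>"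
    and tri: "\<forall>T\<in>F. conforming_triangulation \<Omega> T"
    and shape: "shape_regular F"
    and ref_nodes: "\<forall>i<r. xh i \<in> ref_tri"
    and affine: "\<forall>T\<in>F. \<forall>K\<in>T. (\<exists>B c. invertible B \<and> (\<forall>x. FK T K x = B *v x + c)) \<and>
                                  FK T K ` ref_tri = K"
    and unisolv: "\<forall>T\<in>F. \<forall>K\<in>T. unisolvent (Pkk k k' K) (\<lambda>i. FK T K (xh i)) r"
    and vertices: "\<forall>T\<in>F. \<forall>K\<in>T. verts K \<subseteq> (\<lambda>i. FK T K (xh i)) ` {..<r}"
    and edges: "\<forall>T\<in>F. \<forall>K\<in>T. \<forall>a\<in>verts K. \<forall>b\<in>verts K. a \<noteq> b \<longrightarrow>
                   edge_unisolvent k a b (\<lambda>i. FK T K (xh i)) r"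
    and B1: "\<forall>T\<in>F. \<forall>K\<in>T. \<forall>i<r. w T K i > 0"
    and B2: "\<forall>T\<in>F. \<forall>K\<in>T. \<forall>g\<in>poly2 (k + k' - 2).
                (\<Sum>i<r. w T K i * g (FK T K (xh i))) = integral K g"
  shows "\<exists>C>0. \<forall>T\<in>F. \<forall>\<tau>\<in>Sigma_kkh k k' \<Omega> T.
           lumped lam mu r (w T) (\<lambda>K i. FK T K (xh i)) T \<tau> \<tau> \<ge> C * L2sq \<Omega> \<tau>"
proof -
  define M where "M = 2 * (mu + lam) * lumping_const ref_tri (ref_Pkk k k') xh r"
  have M: "M > 0" using lam mu lumping_const_pos unfolding M_def by simp
  have "L2sq \<Omega> \<tau> \<le> M * lumped lam mu r (w T) (\<lambda>K i. FK T K (xh i)) T \<tau> \<tau>"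
    if T: "T \<in> F" and \<tau>: "\<tau> \<in> Sigma_kkh k k' \<Omega> T" for T \<tau>
  proof -
    have "finite T" "\<Omega> \<subseteq> \<Union>T"
      using tri T closure_subset unfolding conforming_triangulation_def by auto
    moreover have "\<Omega> \<in> sets lebesgue"
      using dom unfolding polygonal_domain_def by simp
    ultimately show ?thesis
      unfolding M_def using T kk affine unisolv B1 B2
      by (intro lumped_coercive[where FK = "FK T" and w = "w T",
            OF lam mu _ _ _ _ _ _ ref_nodes _ _ _ _ \<tau>]) simp_all
  qed
  then have "\<forall>T\<in>F. \<forall>\<tau>\<in>Sigma_kkh k k' \<Omega> T.
      lumped lam mu r (w T) (\<lambda>K i. FK T K (xh i)) T \<tau> \<tau> \<ge> 1 / M * L2sq \<Omega> \<tau>"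
    using M by (simp add: field_simps)
  with M show ?thesis by (intro exI[of _ "1 / M"]) simp
qed

end
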